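(* Let $(X,d)$ be a metric space. The following assertions are equivalent: a) $(X,d)$ is complete; b) the ball space $(X,\mathcal{B}_S)$ is spherically complete for some $S\subset\mathbb{R}^{>0}$ which admits $0$ as its only accumulation point; c) the ball space $(X,\mathcal{B}_S)$ is spherically complete for every $S\subset\mathbb{R}^{>0}$ which admits $0$ as its only accumulation point.
   Context: A ball space $(X,\mathcal{B})$ consists of a nonempty set $X$ and a nonempty family $\mathcal{B}$ of nonempty subsets of $X$, called balls. A nest of balls is a nonempty subset of $\mathcal{B}$ which is totally ordered by inclusion. $(X,\mathcal{B})$ is spherically complete if every nest of balls has nonempty intersection. For a metric space $(X,d)$ (with $X\neq\emptyset$), $x\in X$ and $r\geq 0$, $B_r(x)=\{y\in X\mid d(x,y)\leq r\}$. $\mathbb{R}^{>0}$ is the set of positive real numbers, and for $S\subseteq\mathbb{R}^{>0}$, $\mathcal{B}_S=\{B_r(x)\mid x\in X,\ r\in S\}$. Accumulation points of $S$ are taken in $\mathbb{R}$; "$S$ admits $0$ as its only accumulation point" means that $0$ is an accumulation point of $S$ and no other real number is. *)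

theory Defs
  imports "HOL-Analysis.Analysis"
begin

definition ball_space :: "'a set \<Rightarrow> 'a set set \<Rightarrow> bool" where
  "ball_space X \<B> \<longleftrightarrow> X \<noteq> {} \<and> \<B> \<noteq> {} \<and> (\<forall>B\<in>\<B>. B \<noteq> {} \<and> B \<subseteq> X)"

definition nest_of_balls :: "'a set set \<Rightarrow> 'a set set \<Rightarrow> bool" where
  "nest_of_balls \<B> \<N> \<longleftrightarrow> \<N> \<noteq> {} \<and> subset.chain \<B> \<N>"

definition spherically_complete :: "'a set \<Rightarrow> 'a set set \<Rightarrow> bool" where
  "spherically_complete X \<B> \<longleftrightarrow>
     ball_space X \<B> \<and> (\<forall>\<N>. nest_of_balls \<B> \<N> \<longrightarrow> \<Inter>\<N> \<noteq> {})"

definition metric_balls :: "'a set \<Rightarrow> ('a \<Rightarrow> 'a \<Rightarrow> real) \<Rightarrow> real set \<Rightarrow> 'a set set" where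
  "metric_balls X d S = {Metric_space.mcball X d x r |x r. x \<in> X \<and> r \<in> S}"

definition only_accumulation_point :: "'a::topological_space \<Rightarrow> 'a set \<Rightarrow> bool" where
  "only_accumulation_point a S \<longleftrightarrow> (\<forall>x. x islimpt S \<longleftrightarrow> x = a)"

end

theory Submission
  imports Defs
begin

text \<open>
  Suppose that the space is complete, and let a nest of balls with radii in \<open>S\<close> be given.  If its balls
  have arbitrarily small radii, then they are closed sets of arbitrarily small diameter with the
  finite intersection property, and completeness provides a common point.  If the radii are bounded
  away from \<open>0\<close>, then, since \<open>0\<close> is the only accumulation point of \<open>S\<close>, there is a smallest radius,
  and the centre \<open>x\<close> of a ball \<open>B\<close> with this radius lies in every ball of the nest:  a ball of the
  nest that does not contain \<open>B\<close> is contained in it, so the distance from its centre to \<open>x\<close> is at most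
  the radius of \<open>B\<close>, hence at most its own radius.

  Conversely, since \<open>0\<close> is an accumulation point of \<open>S\<close>, there are radii in \<open>S\<close> that decrease at
  least by half at each step.  Choose such a sequence, and for each of its radii a term of a given
  Cauchy sequence that is followed only by terms much closer to it than the radius.  The balls with
  these radii around these terms form a
  nest, and a point in its intersection is the limit of the sequence.  Finally, the reciprocals of the
  positive integers show that suitable sets \<open>S\<close> exist, so the statement for every \<open>S\<close> implies the one
  for some \<open>S\<close>.
\<close>

section \<open>Sets of radii that accumulate only at zero\<close>

lemma only_accumulation_point_nonempty:
  "only_accumulation_point a S \<Longrightarrow> S \<noteq> {}"
  unfolding only_accumulation_point_def by auto

text \<open>
  A least element exists because, by Bolzano--Weierstrass, only finitely many elements of \<open>S\<close> lie
  between \<open>e\<close> and any given bound.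
\<close>

lemma only_accumulation_point_least:
  fixes S :: "real set"
  assumes acc: "only_accumulation_point 0 S" and R: "R \<subseteq> S" "R \<noteq> {}"
    and e: "0 < e" "\<And>r. r \<in> R \<Longrightarrow> e \<le> r"
  obtains m where "m \<in> R" "\<And>r. r \<in> R \<Longrightarrow> m \<le> r"
proof -
  obtain r0 where r0: "r0 \<in> R"
    using R by blast
  have "finite ({e..r0} \<inter> S)"
    using acc e(1) unfolding only_accumulation_point_def
    by (intro finite_not_islimpt_in_compact) auto
  then have fin: "finite (R \<inter> {..r0})"
    by (rule rev_finite_subset) (use R e in auto)
  have ne: "R \<inter> {..r0} \<noteq> {}"
    using r0 by auto
  have "Min (R \<inter> {..r0}) \<in> R"
    using Min_in[OF fin ne] by blast
  moreover have "Min (R \<inter> {..r0}) \<le> r" if "r \<in> R" for r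
  proof (cases "r \<le> r0")
    case True
    then show ?thesis
      using that fin by auto
  next
    case False
    then show ?thesis
      using Min_in[OF fin ne] by auto
  qed
  ultimately show thesis
    using that by blast
qed

lemma zero_islimpt_small_element:
  fixes S :: "real set"
  assumes "S \<subseteq> {0<..}" "0 islimpt S" "0 < e"
  obtains s where "s \<in> S" "0 < s" "s < e"
proof -
  obtain s where "s \<in> S" "s \<noteq> 0" "dist s 0 < e"
    using assms(2,3) unfolding islimpt_approachable by blast
  then show thesis
    using that assms(1) by auto
qed

lemma halving_sequence:
  fixes S :: "real set"
  assumes S: "S \<subseteq> {0<..}" and "0 islimpt S"
  obtains s :: "nat \<Rightarrow> real"
  where "\<And>n. s n \<in> S" "\<And>n. s (Suc n) \<le> s n / 2" "s \<longlonglongrightarrow> 0"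
proof -
  have "\<exists>s. \<forall>n. s n \<in> S \<and> s (Suc n) \<le> s n / 2"
  proof (rule dependent_nat_choice)
    show "\<exists>x. x \<in> S"
      using zero_islimpt_small_element[OF assms, of 1] by auto
  next
    fix x :: real
    assume "x \<in> S"
    then have "0 < x / 2"
      using S by auto
    then show "\<exists>y. y \<in> S \<and> y \<le> x / 2"
      using zero_islimpt_small_element[OF assms, of "x / 2"] less_imp_le by metis
  qed
  then obtain s where s: "\<And>n. s n \<in> S" "\<And>n. s (Suc n) \<le> s n / 2"
    by blast
  have bound: "s n \<le> s 0 * (1 / 2) ^ n" for n
  proof (induction n)
    case (Suc n)
    then show ?case
      using s(2)[of n] by simp
  qed simp
  have upper: "(\<lambda>n. s 0 * (1 / 2) ^ n) \<longlonglongrightarrow> 0"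
    by (intro tendsto_mult_right_zero LIMSEQ_realpow_zero) auto
  have nonneg: "0 \<le> s n" for n
    using s(1)[of n] S by (auto intro: less_imp_le)
  have "s \<longlonglongrightarrow> 0"
    by (rule tendsto_sandwich[OF _ _ tendsto_const upper]) (simp_all add: nonneg bound)
  then show thesis
    using that s by blast
qed

lemma only_accumulation_point_reciprocals:
  "only_accumulation_point 0 (range (\<lambda>n. inverse (real (Suc n))))"
  unfolding only_accumulation_point_def
proof (intro allI iffI)
  fix x :: real
  assume "x islimpt range (\<lambda>n. inverse (real (Suc n)))"
  then show "x = 0"
    using sequence_unique_limpt[OF LIMSEQ_inverse_real_of_nat] by blast
next
  fix x :: real
  assume "x = 0"
  then show "x islimpt range (\<lambda>n. inverse (real (Suc n)))"
    unfolding islimpt_approachable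
  proof (intro allI impI)
    fix e :: real
    assume "0 < e"
    then obtain n where "inverse (real (Suc n)) < e"
      using reals_Archimedean by blast
    then show "\<exists>y\<in>range (\<lambda>n. inverse (real (Suc n))). y \<noteq> x \<and> dist y x < e"
      using \<open>x = 0\<close> by (intro bexI[of _ "inverse (real (Suc n))"]) (auto simp del: of_nat_Suc)
  qed
qed

section \<open>Nests of metric balls\<close>

context Metric_space
begin

lemma ball_space_metric_balls:
  assumes "M \<noteq> {}" "S \<subseteq> {0<..}" "S \<noteq> {}"
  shows "ball_space M (metric_balls M d S)"
proof -
  have "mcball x r \<noteq> {}" if "x \<in> M" "r \<in> S" for x r
    using that assms(2) by (auto simp: mcball_eq_empty)
  then show ?thesis
    unfolding ball_space_def metric_balls_def using assms(1,3) by auto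
qed

lemma mcomplete_imp_spherically_complete:
  assumes complete: mcomplete and "M \<noteq> {}"
    and S: "S \<subseteq> {0<..}" and acc: "only_accumulation_point 0 S"
  shows "spherically_complete M (metric_balls M d S)"
  unfolding spherically_complete_def
proof (intro conjI allI impI)
  show "ball_space M (metric_balls M d S)"
    using assms ball_space_metric_balls only_accumulation_point_nonempty by blast
next
  fix \<N>
  assume "nest_of_balls (metric_balls M d S) \<N>"
  then have ne: "\<N> \<noteq> {}" and chain: "subset.chain (metric_balls M d S) \<N>"
    unfolding nest_of_balls_def by auto
  have balls: "\<exists>x r. x \<in> M \<and> r \<in> S \<and> B = mcball x r" if "B \<in> \<N>" for B
    using chain that unfolding subset.chain_def metric_balls_def by blast
  \<comment> \<open>One set can be a ball for several radii in \<open>S\<close>; the least radius is taken over all of them.\<close>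
  define R where "R = {r \<in> S. \<exists>x\<in>M. mcball x r \<in> \<N>}"
  show "\<Inter>\<N> \<noteq> {}"
  proof (cases "\<forall>e>0. \<exists>r\<in>R. r < e")
    case True
    have "closedin mtopology B" if "B \<in> \<N>" for B
      using balls[OF that] by auto
    moreover have "\<exists>C a. C \<in> \<N> \<and> C \<subseteq> mcball a e" if e: "0 < e" for e
    proof -
      obtain r x where "r < e" "mcball x r \<in> \<N>"
        using True e unfolding R_def by blast
      then show ?thesis
        using mcball_subset_concentric[of r e x] by auto
    qed
    moreover have "\<Inter>\<F> \<noteq> {}" if "finite \<F>" "\<F> \<subseteq> \<N>" for \<F>
    proof (cases "\<F> = {}")
      case False
      have "subset.chain (metric_balls M d S) \<F>"
        using chain \<open>\<F> \<subseteq> \<N>\<close> unfolding subset.chain_def by blast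
      then have "\<Inter>\<F> \<in> \<F>"
        using \<open>finite \<F>\<close> False by (intro Inter_in_chain)
      then obtain x r where "x \<in> M" "r \<in> S" "\<Inter>\<F> = mcball x r"
        using balls \<open>\<F> \<subseteq> \<N>\<close> by blast
      then show ?thesis
        using S by (auto simp: mcball_eq_empty)
    qed simp
    ultimately show ?thesis
      by (intro complete[unfolded mcomplete_fip, rule_format]) auto
  next
    case False
    then obtain e where e: "0 < e" "\<And>r. r \<in> R \<Longrightarrow> e \<le> r"
      by (meson not_less)
    have "R \<noteq> {}" "R \<subseteq> S"
      using ne balls unfolding R_def by blast+
    then obtain m where "m \<in> R" and least: "\<And>r. r \<in> R \<Longrightarrow> m \<le> r"
      using only_accumulation_point_least[OF acc _ _ e] by blast
    then obtain x where x: "x \<in> M" "mcball x m \<in> \<N>" and "0 < m"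
      using S unfolding R_def by auto
    have "x \<in> B" if "B \<in> \<N>" for B
    proof -
      obtain y r where y: "y \<in> M" and r: "r \<in> S" and B: "B = mcball y r"
        using balls[OF \<open>B \<in> \<N>\<close>] by blast
      have "m \<le> r"
        using y r B that by (intro least) (auto simp: R_def)
      consider "mcball x m \<subseteq> B" | "B \<subseteq> mcball x m"
        using chain x(2) \<open>B \<in> \<N>\<close> unfolding subset.chain_def by blast
      then show ?thesis
      proof cases
        case 1
        then show ?thesis
          using x \<open>0 < m\<close> by auto
      next
        case 2
        moreover have "y \<in> B"
          using y \<open>m \<le> r\<close> \<open>0 < m\<close> B by simp
        ultimately have "y \<in> mcball x m"
          by blast
        then show ?thesis
          using x y B \<open>m \<le> r\<close> by (simp add: commute)
      qed
    qed
    then show ?thesis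
      by blast
  qed
qed

lemma spherically_complete_imp_mcomplete:
  assumes S: "S \<subseteq> {0<..}" and acc: "0 islimpt S"
    and sph: "spherically_complete M (metric_balls M d S)"
  shows mcomplete
  unfolding mcomplete_def
proof (intro allI impI)
  fix \<sigma>
  assume cauchy: "MCauchy \<sigma>"
  then have \<sigma>M: "\<sigma> n \<in> M" for n
    unfolding MCauchy_def by auto
  obtain s where sS: "\<And>k. s k \<in> S" and half: "\<And>k. s (Suc k) \<le> s k / 2" and lim: "s \<longlonglongrightarrow> 0"
    using halving_sequence[OF S acc] by blast
  have pos: "0 < s k" for k
    using sS S by auto
  have "\<exists>N. \<forall>n\<ge>N. d (\<sigma> N) (\<sigma> n) < s k / 4" for k
  proof -
    have "0 < s k / 4"
      using pos by simp
    then show ?thesis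
      using cauchy unfolding MCauchy_def by (meson order_refl)
  qed
  then obtain N where N: "\<And>k n. N k \<le> n \<Longrightarrow> d (\<sigma> (N k)) (\<sigma> n) < s k / 4"
    by metis
  define C where "C k = mcball (\<sigma> (N k)) (s k)" for k
  \<comment> \<open>The centres are at distance less than \<open>s k / 4 + s (Suc k) / 4\<close>, through any later term of \<open>\<sigma>\<close>.\<close>
  have "C (Suc k) \<subseteq> C k" for k
    unfolding C_def
  proof (rule mcball_subset)
    define n where "n = max (N k) (N (Suc k))"
    have "d (\<sigma> (N (Suc k))) (\<sigma> (N k)) \<le> d (\<sigma> (N (Suc k))) (\<sigma> n) + d (\<sigma> n) (\<sigma> (N k))"
      using \<sigma>M by (intro triangle) auto
    moreover have "d (\<sigma> (N (Suc k))) (\<sigma> n) < s (Suc k) / 4" "d (\<sigma> n) (\<sigma> (N k)) < s k / 4"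
      using N[of "Suc k" n] N[of k n] unfolding n_def by (auto simp: commute)
    ultimately show "d (\<sigma> (N (Suc k))) (\<sigma> (N k)) + s (Suc k) \<le> s k"
      using half[of k] pos[of k] by linarith
  qed (rule \<sigma>M)
  then have "decseq C"
    by (rule decseq_SucI)
  then have "C i \<subseteq> C j \<or> C j \<subseteq> C i" for i j
    using nat_le_linear[of i j] by (auto dest: decseqD)
  moreover have "C k \<in> metric_balls M d S" for k
    unfolding C_def metric_balls_def using \<sigma>M sS by blast
  ultimately have "nest_of_balls (metric_balls M d S) (range C)"
    unfolding nest_of_balls_def subset_chain_def by auto
  then obtain y where y: "\<And>k. y \<in> C k"
    using sph unfolding spherically_complete_def by blast
  have yM: "y \<in> M"
    using y[of 0] unfolding C_def by auto
  have "limitin mtopology \<sigma> y sequentially"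
    unfolding limit_metric_sequentially
  proof (intro conjI allI impI yM)
    fix e :: real
    assume "0 < e"
    then have "eventually (\<lambda>k. s k < e / 2) sequentially"
      using lim by (intro order_tendstoD(2)) auto
    then obtain k where k: "s k < e / 2"
      using eventually_happens' sequentially_bot by blast
    have "\<sigma> n \<in> M \<and> d (\<sigma> n) y < e" if "N k \<le> n" for n
    proof -
      have "d (\<sigma> n) y \<le> d (\<sigma> n) (\<sigma> (N k)) + d (\<sigma> (N k)) y"
        using \<sigma>M yM by (intro triangle) auto
      moreover have "d (\<sigma> n) (\<sigma> (N k)) < s k / 4"
        using N[OF that] by (simp add: commute)
      moreover have "d (\<sigma> (N k)) y \<le> s k"
        using y[of k] unfolding C_def by auto
      ultimately show ?thesis
        using k pos[of k] \<sigma>M by auto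
    qed
    then show "\<exists>N. \<forall>n\<ge>N. \<sigma> n \<in> M \<and> d (\<sigma> n) y < e"
      by blast
  qed
  then show "\<exists>x. limitin mtopology \<sigma> x sequentially"
    by blast
qed

end

section \<open>Completeness and spherical completeness\<close>

theorem theorem5p6:
  fixes X :: "'a set" and d :: "'a \<Rightarrow> 'a \<Rightarrow> real"
  assumes "Metric_space X d" and "X \<noteq> {}"
  shows "(Metric_space.mcomplete X d \<longleftrightarrow>
           (\<exists>S::real set. S \<subseteq> {0<..} \<and> only_accumulation_point 0 S \<and>
              spherically_complete X (metric_balls X d S)))
       \<and> (Metric_space.mcomplete X d \<longleftrightarrow>
           (\<forall>S::real set. S \<subseteq> {0<..} \<and> only_accumulation_point 0 S \<longrightarrow>
              spherically_complete X (metric_balls X d S)))"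
proof -
  interpret Metric_space X d
    by (rule assms(1))
  have every: "spherically_complete X (metric_balls X d S)"
    if "mcomplete" "S \<subseteq> {0<..}" "only_accumulation_point 0 S" for S
    using that assms(2) by (intro mcomplete_imp_spherically_complete)
  have some: "mcomplete"
    if "S \<subseteq> {0<..}" "only_accumulation_point 0 S" "spherically_complete X (metric_balls X d S)" for S
    using that by (auto simp: only_accumulation_point_def intro: spherically_complete_imp_mcomplete)
  have "range (\<lambda>n. inverse (real (Suc n))) \<subseteq> {0<..}"
    by auto
  then show ?thesis
    using every some only_accumulation_point_reciprocals by meson
qed

end
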